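(* Assume the loss is uniformly bounded: there is a constant $L_{\max}$ with $\ell(f_{\bm\theta}(\mathbf{x}),y)\le L_{\max}$ for all $\bm\theta$ and all $(\mathbf{x},y)$. Let $(\bm\theta^*,\bm\phi^* )$ be the learned parameters, let $1\le B<\hat B$ be integers, and let $(\mathbf{x}^{(i)},y^{(i)})$, $i=1,\dots,\hat B$, be a candidate batch drawn i.i.d. from $p(\mathbf{x},y)$. Write $\ell=\ell(f_{\bm\theta^*}(\mathbf{x}),y)$ for $(\mathbf{x},y)\sim p$, $\ell^{(i)}=\ell(f_{\bm\theta^*}(\mathbf{x}^{(i)}),y^{(i)})$, and let $z^{(i)}\in\{0,1\}$ indicate whether candidate $i$ is among the $B$ candidates with the largest predicted losses $g_{\bm\phi^*}(\mathbf{x}^{(i)})$, so that $\sum_{i=1}^{\hat B}z^{(i)}=B$. Define $$R(\bm\theta^*,\bm\phi^* )=\mathbb{E}_{p(\mathbf{x},y)}[\ell],\qquad \widehat R(\bm\theta^*,\bm\phi^* )=\frac1{\hat B}\sum_{i=1}^{\hat B}z^{(i)}\ell^{(i)}.$$ Then for any $\epsilon\in(0,1)$, with probability at least $1-\epsilon$, $$\left|R(\bm\theta^*,\bm\phi^* )-\widehat R(\bm\theta^*,\bm\phi^* )\right|<\sqrt{\left(\mathbb{V}[\ell]+\frac{L_{\max}}{3}\right)\frac{2\ln\left(\frac1\epsilon\right)}{\hat B}}+L_{\max}\sqrt{\frac{\hat B}{2B^2}\ln\left(\frac1\epsilon\right)}+\frac{L_{\max}(\hat B-B)}{\hat B},$$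 where $\mathbb{V}[\ell]$ denotes the variance of $\ell$ under $p(\mathbf{x},y)$.
   Context: Data pairs $(\mathbf{x},y)\in\mathcal{X}\times\mathcal{Y}$ (input and label) have distribution $p(\mathbf{x},y)$. The classifier $f_{\bm\theta}$ is parameterized by $\bm\theta\in\bm\Theta$, and $\ell(\cdot,\cdot)\ge 0$ is the cross-entropy loss. The pre-evaluation module $g_{\bm\phi}:\mathcal{X}\to\mathbb{R}$, parameterized by $\bm\phi\in\bm\Phi$, predicts the loss of a sample. The learned parameters $(\bm\theta^*,\bm\phi^* )$ are regarded as given. From a candidate batch of size $\hat B$, the method selects the $B<\hat B$ samples with the largest predicted losses under $g_{\bm\phi^*}$.
   Formalization: The constant L_max is assumed to be strictly positive; if L_max = 0 the loss is identically zero and the claimed strict inequality would read 0 < 0, which is false. *)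

theory Defs
  imports "HOL-Probability.Probability"
begin

definition sample_loss ::
    "('o \<Rightarrow> 'y \<Rightarrow> real) \<Rightarrow> ('t \<Rightarrow> 'x \<Rightarrow> 'o) \<Rightarrow> 't \<Rightarrow> 'x \<times> 'y \<Rightarrow> real" where
  "sample_loss l f \<theta> = (\<lambda>(x, y). l (f \<theta> x) y)"

definition true_risk ::
    "('x \<times> 'y) measure \<Rightarrow> ('o \<Rightarrow> 'y \<Rightarrow> real) \<Rightarrow> ('t \<Rightarrow> 'x \<Rightarrow> 'o) \<Rightarrow> 't \<Rightarrow> real" where
  "true_risk p l f \<theta> = prob_space.expectation p (sample_loss l f \<theta>)"

text \<open>
  The indicators \<open>z\<close> mark \<open>B\<close> of the candidates \<open>1, \<dots>, n\<close> having the largest scores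
  \<open>s\<close>.  Tied scores may leave several admissible choices of \<open>z\<close>; no tie-breaking rule
  is imposed.
\<close>

definition top_indicators :: "nat \<Rightarrow> nat \<Rightarrow> (nat \<Rightarrow> real) \<Rightarrow> (nat \<Rightarrow> real) \<Rightarrow> bool" where
  "top_indicators n B s z \<longleftrightarrow>
     (\<forall>i\<in>{1..n}. z i \<in> {0, 1}) \<and>
     (\<Sum>i=1..n. z i) = real B \<and>
     (\<forall>i\<in>{1..n}. \<forall>j\<in>{1..n}. z i = 1 \<and> z j = 0 \<longrightarrow> s j \<le> s i)"

text \<open>The normalisation is by the candidate batch size \<open>n\<close>, not by the number of
  selected candidates.\<close>

definition selected_risk :: "nat \<Rightarrow> (nat \<Rightarrow> real) \<Rightarrow> (nat \<Rightarrow> real) \<Rightarrow> real" where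
  "selected_risk n z ls = 1 / real n * (\<Sum>i=1..n. z i * ls i)"

end

theory Submission
  imports Defs
begin

text \<open>
  After rescaling, the centered losses \<open>Y\<^sub>i\<close> take values in \<open>{-m..1-m}\<close>; let \<open>Z\<close> be their sum over
  the \<open>n\<close> candidates and \<open>v\<close> their variance. Leaving out \<open>n - B \<ge> 1\<close> candidates changes the empirical
  risk by an amount in \<open>[0, L (n - B) / n]\<close>, and with \<open>\<kappa> = ln (1 / \<epsilon>)\<close> the two square roots dominate
  \<open>L s / n\<close> for \<open>s = sqrt (n \<kappa> / 2) * (n / (n - 1) + 2 * sqrt v)\<close>. So it suffices that \<open>-s < Z < s + 1\<close>
  with probability at least \<open>1 - exp (-\<kappa>)\<close>. This is a two-sided bound without the factor \<open>2\<close> of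
  Hoeffding's inequality. For \<open>\<kappa> > 3\<close> the factor is absorbed by Hoeffding's inequality, or by a
  Bernstein bound if \<open>v\<close> is tiny; for moderate \<open>\<kappa>\<close> Chebyshev's inequality is enough. For small \<open>s\<close>
  one needs anti-concentration: if \<open>F\<close> clips its argument to \<open>[-s, s+1]\<close>, then \<open>Z F(Z)\<close> is at least
  \<open>s\<^sup>2\<close> outside \<open>(-s, s+1)\<close>, while exchanging one \<open>Y\<^sub>i\<close> for an independent copy moves \<open>Z\<close> by at most
  \<open>1\<close>, so that \<open>F(Z)\<close> changes only if one of the two sums lies in \<open>(-s, s+1)\<close>. This bounds
  \<open>E (Z F(Z))\<close>, hence the probability of being outside, by a multiple of the probability of being inside.
\<close>

section \<open>Clipping and the exchange of one summand\<close>

definition clip :: "real \<Rightarrow> real \<Rightarrow> real" where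
  "clip s x = max (- s) (min (s + 1) x)"

lemma clip_measurable [measurable]: "clip s \<in> borel_measurable borel"
  unfolding clip_def[abs_def] by measurable

lemma abs_clip_le: "0 \<le> s \<Longrightarrow> \<bar>clip s x\<bar> \<le> s + 1"
  by (auto simp: clip_def)

text \<open>The interval \<open>{-s<..<s+1}\<close> has length \<open>2 * s + 1 > 1\<close>, so a
  move of size at most \<open>1\<close> cannot jump across it: if neither point lies inside, both
  lie on the same side and are clipped to the same value. Otherwise at least one indicator is
  \<open>1\<close>, and \<open>clip s\<close> is 1-Lipschitz.\<close>

lemma clip_increment_le:
  fixes w x y :: real
  assumes "0 < s" "\<bar>x - y\<bar> \<le> 1"
  shows "(x - y) * (clip s (w + x) - clip s (w + y)) \<le>
    (x - y)\<^sup>2 * (indicator {-s<..<s+1} (w + x) + indicator {-s<..<s+1} (w + y))"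
proof -
  let ?d = "clip s (w + x) - clip s (w + y)"
  show ?thesis
  proof (cases "w + x \<in> {-s<..<s+1} \<or> w + y \<in> {-s<..<s+1}")
    case True
    have "\<bar>?d\<bar> \<le> \<bar>x - y\<bar>"
      by (auto simp: clip_def)
    hence "(x - y) * ?d \<le> \<bar>x - y\<bar> * \<bar>x - y\<bar>"
      by (metis abs_ge_self abs_ge_zero abs_mult mult_left_mono order_trans)
    also have "\<dots> = (x - y)\<^sup>2 * 1"
      by (simp add: power2_eq_square)
    also have "\<dots> \<le> (x - y)\<^sup>2 * (indicator {-s<..<s+1} (w + x) + indicator {-s<..<s+1} (w + y))"
      using True by (intro mult_left_mono) (auto simp: indicator_def)
    finally show ?thesis .
  next
    case False
    hence "?d = 0"
      using assms by (auto simp: clip_def)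
    thus ?thesis
      by simp
  qed
qed

lemma mult_clip_ge:
  assumes "0 < s"
  shows "s\<^sup>2 * indicator (- {-s<..<s+1}) x \<le> x * clip s x"
proof (cases "x \<in> {-s<..<s+1}")
  case True
  then show ?thesis
    by (simp add: clip_def)
next
  case False
  consider "x \<le> -s" | "s + 1 \<le> x"
    using False by force
  thus ?thesis
  proof cases
    case 1
    hence "s * s \<le> (-x) * s" using assms by (intro mult_right_mono) auto
    thus ?thesis using 1 assms False by (simp add: clip_def power2_eq_square)
  next
    case 2
    hence "s * s \<le> x * (s + 1)" using assms by (intro mult_mono) auto
    thus ?thesis using 2 assms False by (simp add: clip_def power2_eq_square)
  qed
qed

lemma (in prob_space) expectation_mult_clip_le:
  fixes Y :: "'a \<Rightarrow> real"
  assumes [measurable]: "random_variable borel Y"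
    and bounds: "\<And>\<omega>. \<omega> \<in> space M \<Longrightarrow> Y \<omega> \<in> {-m..1-m}"
    and mean: "expectation Y = 0" and "0 < s"
  shows "expectation (\<lambda>\<omega>. Y \<omega> * clip s (w + Y \<omega>)) \<le>
    expectation (\<lambda>\<omega>. ((Y \<omega>)\<^sup>2 + expectation (\<lambda>\<omega>. (Y \<omega>)\<^sup>2)) * indicator {-s<..<s+1} (w + Y \<omega>))"
proof -
  define v where "v = expectation (\<lambda>\<omega>. (Y \<omega>)\<^sup>2)"
  define J :: "real \<Rightarrow> real" where "J y = indicator {-s<..<s+1} (w + y)" for y
  define F where "F y = clip s (w + y)" for y
  have [measurable]: "J \<in> borel_measurable borel" "F \<in> borel_measurable borel"
    unfolding J_def[abs_def] F_def[abs_def] by measurable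
  have Y: "\<bar>Y \<omega>\<bar> \<le> \<bar>m\<bar> + 1" if "\<omega> \<in> space M" for \<omega>
    using bounds[OF that] by auto
  have Y2: "(Y \<omega>)\<^sup>2 \<le> (\<bar>m\<bar> + 1)\<^sup>2" if "\<omega> \<in> space M" for \<omega>
    using Y[OF that] by (metis abs_ge_zero power2_abs power_mono)
  have J: "\<bar>J y\<bar> \<le> 1" "0 \<le> J y" for y by (auto simp: J_def indicator_def)
  have F: "\<bar>F y\<bar> \<le> s + 1" for y
    using abs_clip_le[of s] assms by (simp add: F_def)
  have iY: "integrable M Y"
    using Y by (intro integrable_const_bound[where B = "\<bar>m\<bar> + 1"]) auto
  have iY2: "integrable M (\<lambda>\<omega>. (Y \<omega>)\<^sup>2)"
    using Y2 by (intro integrable_const_bound[where B = "(\<bar>m\<bar> + 1)\<^sup>2"]) auto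
  have iF: "integrable M (\<lambda>\<omega>. F (Y \<omega>))"
    using F by (intro integrable_const_bound[where B = "s + 1"]) auto
  have iJ: "integrable M (\<lambda>\<omega>. J (Y \<omega>))"
    using J by (intro integrable_const_bound[where B = 1]) auto
  have iYF: "integrable M (\<lambda>\<omega>. Y \<omega> * F (Y \<omega>))"
    using F Y by (intro integrable_const_bound[where B = "(\<bar>m\<bar> + 1) * (s + 1)"])
      (auto simp: abs_mult intro!: mult_mono)
  have iYJ: "integrable M (\<lambda>\<omega>. Y \<omega> * J (Y \<omega>))"
    using J Y by (intro integrable_const_bound[where B = "(\<bar>m\<bar> + 1) * 1"])
      (auto simp only: abs_mult real_norm_def intro!: mult_mono AE_I2, auto)
  have iY2J: "integrable M (\<lambda>\<omega>. (Y \<omega>)\<^sup>2 * J (Y \<omega>))"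
    using J Y2 by (intro integrable_const_bound[where B = "(\<bar>m\<bar> + 1)\<^sup>2 * 1"])
      (auto simp only: abs_mult real_norm_def abs_power2 intro!: mult_mono AE_I2, auto)
  note ints = iY iY2 iF iJ iYF iYJ iY2J
  define A where "A = expectation (\<lambda>\<omega>. Y \<omega> * F (Y \<omega>))"
  define G where "G = expectation (\<lambda>\<omega>. F (Y \<omega>))"
  define P where "P = expectation (\<lambda>\<omega>. J (Y \<omega>))"
  define Q1 where "Q1 = expectation (\<lambda>\<omega>. Y \<omega> * J (Y \<omega>))"
  define Q2 where "Q2 = expectation (\<lambda>\<omega>. (Y \<omega>)\<^sup>2 * J (Y \<omega>))"
  \<comment> \<open>\<open>y\<close> stands for the value of an independent copy of \<open>Y\<close>, which is integrated out afterwards.\<close>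
  have inner: "A - y * G + y * F y \<le> Q2 - 2 * y * Q1 + y\<^sup>2 * P + J y * (v + y\<^sup>2)"
    if "y \<in> {-m..1-m}" for y
  proof -
    have "A - y * G + y * F y =
        expectation (\<lambda>\<omega>. Y \<omega> * F (Y \<omega>) - y * F (Y \<omega>) - Y \<omega> * F y + y * F y)"
      using ints mean by (simp add: A_def G_def prob_space)
    also have "\<dots> \<le> expectation (\<lambda>\<omega>. (Y \<omega>)\<^sup>2 * J (Y \<omega>) - 2 * y * (Y \<omega> * J (Y \<omega>)) + y\<^sup>2 * J (Y \<omega>)
        + J y * (Y \<omega>)\<^sup>2 - 2 * y * J y * Y \<omega> + J y * y\<^sup>2)"
    proof (intro integral_mono)
      fix \<omega> assume "\<omega> \<in> space M"
      hence "\<bar>Y \<omega> - y\<bar> \<le> 1" using bounds[of \<omega>] that by auto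
      from clip_increment_le[OF \<open>0 < s\<close> this, of w]
      show "Y \<omega> * F (Y \<omega>) - y * F (Y \<omega>) - Y \<omega> * F y + y * F y \<le> (Y \<omega>)\<^sup>2 * J (Y \<omega>)
          - 2 * y * (Y \<omega> * J (Y \<omega>)) + y\<^sup>2 * J (Y \<omega>) + J y * (Y \<omega>)\<^sup>2 - 2 * y * J y * Y \<omega> + J y * y\<^sup>2"
        unfolding F_def[symmetric] J_def[symmetric] by (simp add: algebra_simps power2_eq_square)
    qed (use ints in auto)
    also have "\<dots> = Q2 - 2 * y * Q1 + y\<^sup>2 * P + J y * (v + y\<^sup>2)"
      using ints mean by (simp add: prob_space) (simp add: Q1_def Q2_def P_def v_def algebra_simps)
    finally show ?thesis .
  qed
  \<comment> \<open>The second integration replaces \<open>y\<close> by \<open>Y\<close>. Terms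
    linear in \<open>y\<close> vanish, and by symmetry the two copies contribute equally, hence the
    factor \<open>2\<close> on both sides.\<close>
  have "2 * A = expectation (\<lambda>\<omega>. A - Y \<omega> * G + Y \<omega> * F (Y \<omega>))"
    using ints mean by (simp add: prob_space) (simp add: A_def)
  also have "\<dots> \<le> expectation (\<lambda>\<omega>. Q2 - 2 * Y \<omega> * Q1 + (Y \<omega>)\<^sup>2 * P + J (Y \<omega>) * v + (Y \<omega>)\<^sup>2 * J (Y \<omega>))"
  proof (intro integral_mono)
    fix \<omega> assume "\<omega> \<in> space M"
    from inner[OF bounds[OF this]]
    show "A - Y \<omega> * G + Y \<omega> * F (Y \<omega>) \<le>
        Q2 - 2 * Y \<omega> * Q1 + (Y \<omega>)\<^sup>2 * P + J (Y \<omega>) * v + (Y \<omega>)\<^sup>2 * J (Y \<omega>)"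
      by (simp add: algebra_simps)
  qed (use ints in auto)
  also have "\<dots> = 2 * (Q2 + v * P)"
    using ints mean by (simp add: prob_space) (simp add: v_def P_def Q2_def)
  finally have "A \<le> Q2 + v * P" by simp
  also have "\<dots> = expectation (\<lambda>\<omega>. ((Y \<omega>)\<^sup>2 + v) * J (Y \<omega>))"
    using ints by (simp add: algebra_simps Q2_def P_def)
  finally show ?thesis
    by (simp add: A_def F_def J_def v_def)
qed

text \<open>Independence makes the joint law a product, so by Fubini \<open>W\<close> can be frozen
  at a constant \<open>w\<close> while \<open>Y\<close> is integrated out.\<close>

lemma (in prob_space) indep_var_expectation_nonpos:
  fixes h :: "real \<Rightarrow> real \<Rightarrow> real"
  assumes indep: "indep_var borel Y borel W"
    and h: "(\<lambda>(y, w). h y w) \<in> borel_measurable (borel \<Otimes>\<^sub>M borel)"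
    and int: "integrable M (\<lambda>\<omega>. h (Y \<omega>) (W \<omega>))"
    and nonpos: "\<And>w. expectation (\<lambda>\<omega>. h (Y \<omega>) w) \<le> 0"
  shows "expectation (\<lambda>\<omega>. h (Y \<omega>) (W \<omega>)) \<le> 0"
proof -
  have rv [measurable]: "random_variable borel Y" "random_variable borel W"
    and eq: "distr M borel Y \<Otimes>\<^sub>M distr M borel W = distr M (borel \<Otimes>\<^sub>M borel) (\<lambda>x. (Y x, W x))"
    using indep unfolding indep_var_distribution_eq by auto
  interpret DY: prob_space "distr M borel Y" by (rule prob_space_distr) fact
  interpret DW: prob_space "distr M borel W" by (rule prob_space_distr) fact
  interpret P: pair_sigma_finite "distr M borel Y" "distr M borel W" ..
  have h1: "(\<lambda>y. h y w) \<in> borel_measurable borel" for w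
    using measurable_compose[OF measurable_Pair2'[of w] h] by simp
  have i: "integrable (distr M borel Y \<Otimes>\<^sub>M distr M borel W) (\<lambda>(y, w). h y w)"
    unfolding eq using int h by (subst integrable_distr_eq) auto
  have "expectation (\<lambda>\<omega>. h (Y \<omega>) (W \<omega>)) =
      integral\<^sup>L (distr M (borel \<Otimes>\<^sub>M borel) (\<lambda>x. (Y x, W x))) (\<lambda>(y, w). h y w)"
    using h by (subst integral_distr) auto
  also have "\<dots> = (\<integral>w. \<integral>y. h y w \<partial>distr M borel Y \<partial>distr M borel W)"
    unfolding eq[symmetric] using P.integral_snd[OF i] by simp
  also have "\<dots> \<le> 0"
  proof -
    have "(\<integral>y. h y w \<partial>distr M borel Y) \<le> 0" for w
      using nonpos[of w] h1 by (subst integral_distr) auto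
    hence "0 \<le> (\<integral>w. - (\<integral>y. h y w \<partial>distr M borel Y) \<partial>distr M borel W)"
      by (intro integral_nonneg_AE) simp
    thus ?thesis by simp
  qed
  finally show ?thesis .
qed

section \<open>Elementary bounds for the exponential function\<close>

lemma exp_3_le: "exp 3 \<le> (22 :: real)"
proof -
  have "exp (3::real) = exp 1 ^ 3"
    by (simp flip: exp_of_nat_mult)
  also have "\<dots> \<le> (272/100) ^ 3"
    using e_less_272 by (intro power_mono) auto
  also have "\<dots> \<le> 22"
    by (simp add: power3_eq_cube)
  finally show ?thesis .
qed

text \<open>Taylor expansion with Lagrange remainder \<open>exp t / 2 * x^2\<close>; the constant
  \<open>11\<close> is half of the bound \<open>22\<close> for \<open>exp 3\<close>.\<close>

lemma exp_le_quadratic: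
  fixes x :: real
  assumes "\<bar>x\<bar> \<le> 3"
  shows "exp x \<le> 1 + x + 11 * x\<^sup>2"
proof -
  obtain t where t: "\<bar>t\<bar> \<le> \<bar>x\<bar>" "exp x = (\<Sum>m<2. x ^ m / fact m) + exp t / fact 2 * x ^ 2"
    using Maclaurin_exp_le[of x 2] by blast
  have "exp t \<le> 22"
    using order_trans[of "exp t" "exp 3" 22] exp_3_le t assms by simp
  hence "exp t / 2 * x\<^sup>2 \<le> 11 * x\<^sup>2"
    by (intro mult_right_mono) auto
  thus ?thesis
    using t(2) by (simp add: numeral_2_eq_2)
qed

section \<open>Sums of independent centered variables\<close>

text \<open>Adding \<open>m\<close> to the summands gives variables with values in
  \<open>[0, 1]\<close> and mean \<open>m\<close>; in the application these are the losses divided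
  by their bound.\<close>

locale centered_sample = prob_space +
  fixes Y :: "'i \<Rightarrow> 'a \<Rightarrow> real" and I :: "'i set" and m v :: real
  assumes fin: "finite I" and nonempty: "I \<noteq> {}"
    and indep: "indep_vars (\<lambda>_. borel) Y I"
    and bounds: "\<And>i \<omega>. i \<in> I \<Longrightarrow> \<omega> \<in> space M \<Longrightarrow> Y i \<omega> \<in> {-m..1-m}"
    and mean: "\<And>i. i \<in> I \<Longrightarrow> expectation (Y i) = 0"
    and second_moment: "\<And>i. i \<in> I \<Longrightarrow> expectation (\<lambda>\<omega>. (Y i \<omega>)\<^sup>2) = v"
begin

definition Z :: "'a \<Rightarrow> real" where
  "Z \<omega> = (\<Sum>i\<in>I. Y i \<omega>)"

definition n :: real where
  "n = real (card I)"

lemma n_pos: "0 < n"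
  using fin nonempty by (simp add: n_def card_gt_0_iff)

lemma rv [measurable]: "i \<in> I \<Longrightarrow> random_variable borel (Y i)"
  using indep unfolding indep_vars_def by blast

lemma Z_measurable [measurable]: "random_variable borel Z"
  unfolding Z_def[abs_def] by measurable

lemma m_bounds: "0 \<le> m" "m \<le> 1"
proof -
  obtain i where i: "i \<in> I" using nonempty by blast
  have int: "integrable M (Y i)"
    using bounds[OF i] i by (intro integrable_const_bound[where B = "\<bar>m\<bar> + 1"] AE_I2) force+
  have "-m \<le> expectation (Y i)" "expectation (Y i) \<le> 1 - m"
    using integral_mono[of M "\<lambda>_. -m" "Y i"] integral_mono[of M "Y i" "\<lambda>_. 1-m"] int bounds[OF i]
    by (auto simp: prob_space)
  thus "0 \<le> m" "m \<le> 1" using mean[OF i] by auto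
qed

lemma abs_Y_le: "i \<in> I \<Longrightarrow> \<omega> \<in> space M \<Longrightarrow> \<bar>Y i \<omega>\<bar> \<le> 1"
  using bounds m_bounds by fastforce

text \<open>The product of the distances to the two endpoints is nonnegative. The linear term is
  kept because it sums to a multiple of \<open>Z\<close>, which is controlled inside the interval;
  in expectation it vanishes, which gives \<open>v \<le> m * (1 - m) \<le> 1 / 4\<close>.\<close>

lemma Y_square_le: "i \<in> I \<Longrightarrow> \<omega> \<in> space M \<Longrightarrow> (Y i \<omega>)\<^sup>2 \<le> (1 - 2 * m) * Y i \<omega> + m * (1 - m)"
proof -
  assume "i \<in> I" "\<omega> \<in> space M"
  hence "0 \<le> (Y i \<omega> + m) * (1 - m - Y i \<omega>)"
    using bounds[of i \<omega>] by (intro mult_nonneg_nonneg) auto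
  thus ?thesis by (simp add: algebra_simps power2_eq_square)
qed

lemma abs_Z_le: "\<omega> \<in> space M \<Longrightarrow> \<bar>Z \<omega>\<bar> \<le> n"
  using order_trans[OF sum_abs sum_bounded_above[of I "\<lambda>i. \<bar>Y i \<omega>\<bar>" 1]] abs_Y_le
  by (simp add: Z_def n_def)

lemma integrable_bounded:
  assumes "random_variable borel f" "\<And>\<omega>. \<omega> \<in> space M \<Longrightarrow> \<bar>f \<omega>\<bar> \<le> b"
  shows "integrable M (f :: _ \<Rightarrow> real)"
  using assms by (intro integrable_const_bound[where B = b]) auto

lemma Y_integrable: "i \<in> I \<Longrightarrow> integrable M (Y i)"
  using abs_Y_le by (intro integrable_bounded) auto

lemma Y_square_integrable: "i \<in> I \<Longrightarrow> integrable M (\<lambda>\<omega>. (Y i \<omega>)\<^sup>2)"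
  using abs_Y_le by (intro integrable_bounded[where b = 1]) (auto simp: abs_square_le_1)

lemma v_bounds: "0 \<le> v" "v \<le> 1 / 4"
proof -
  obtain i where i: "i \<in> I" using nonempty by blast
  have "expectation (\<lambda>\<omega>. (Y i \<omega>)\<^sup>2) \<le> expectation (\<lambda>\<omega>. (1 - 2 * m) * Y i \<omega> + m * (1 - m))"
    using Y_integrable Y_square_integrable Y_square_le i by (intro integral_mono) auto
  also have "\<dots> = m * (1 - m)"
    using Y_integrable i mean by (simp add: prob_space)
  also have "\<dots> \<le> 1 / 4"
    using zero_le_power2[of "m - 1/2"] by (simp add: power2_eq_square algebra_simps)
  finally show "v \<le> 1 / 4" using second_moment i by simp
  show "0 \<le> v" using second_moment[OF i] by (metis integral_nonneg_AE AE_I2 zero_le_power2)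
qed

lemma Z_split: "i \<in> I \<Longrightarrow> Z \<omega> = (\<Sum>j\<in>I - {i}. Y j \<omega>) + Y i \<omega>"
  using fin by (simp add: Z_def sum.remove)

lemma indep_rest: "i \<in> I \<Longrightarrow> indep_var borel (Y i) borel (\<lambda>\<omega>. \<Sum>j\<in>I - {i}. Y j \<omega>)"
  using fin indep by (intro indep_vars_sum) (auto simp: insert_absorb)

lemma expectation_Z: "expectation Z = 0"
  unfolding Z_def[abs_def] using Y_integrable mean by (subst Bochner_Integration.integral_sum) auto

lemma expectation_Z_square: "expectation (\<lambda>\<omega>. (Z \<omega>)\<^sup>2) = n * v"
proof -
  have *: "integrable M (\<lambda>\<omega>. Y i \<omega> * Z \<omega>) \<and> expectation (\<lambda>\<omega>. Y i \<omega> * Z \<omega>) = v" if i: "i \<in> I" for i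
  proof -
    let ?W = "\<lambda>\<omega>. \<Sum>j\<in>I - {i}. Y j \<omega>"
    have W: "integrable M ?W"
      using Y_integrable by auto
    have "integrable M (\<lambda>\<omega>. Y i \<omega> * ?W \<omega>)" "expectation (\<lambda>\<omega>. Y i \<omega> * ?W \<omega>) = 0"
      using indep_var_integrable[OF indep_rest[OF i] Y_integrable[OF i] W]
        indep_var_lebesgue_integral[OF indep_rest[OF i] Y_integrable[OF i] W] mean[OF i] by auto
    thus ?thesis
      using Y_square_integrable[OF i] second_moment[OF i]
      by (simp add: Z_split[OF i] distrib_left flip: power2_eq_square)
  qed
  have "expectation (\<lambda>\<omega>. (Z \<omega>)\<^sup>2) = expectation (\<lambda>\<omega>. \<Sum>i\<in>I. Y i \<omega> * Z \<omega>)"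
    by (simp add: Z_def power2_eq_square sum_distrib_right)
  also have "\<dots> = n * v"
    using * by (subst Bochner_Integration.integral_sum) (auto simp: n_def)
  finally show ?thesis .
qed

section \<open>Tail bounds of Chebyshev, Hoeffding and Bernstein type\<close>

lemma Chebyshev:
  assumes "0 < s"
  shows "prob {\<omega> \<in> space M. s \<le> \<bar>Z \<omega>\<bar>} \<le> n * v / s\<^sup>2"
proof -
  have "integrable M (\<lambda>\<omega>. (Z \<omega>)\<^sup>2)"
    using abs_Z_le n_pos by (intro integrable_bounded[where b = "n\<^sup>2"]) (auto simp: abs_le_square_iff[symmetric])
  from Chebyshev_inequality[OF Z_measurable this assms] show ?thesis
    by (simp add: expectation_Z expectation_Z_square)
qed

lemma Hoeffding:
  assumes "0 \<le> s"
  shows "prob {\<omega> \<in> space M. s \<le> \<bar>Z \<omega>\<bar>} \<le> 2 * exp (- 2 * s\<^sup>2 / n)"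
proof -
  interpret Hoeffding_ineq M I Y "\<lambda>_. -m" "\<lambda>_. 1-m" "\<Sum>i\<in>I. expectation (Y i)"
    using fin indep bounds by unfold_locales (auto intro: AE_I2)
  show ?thesis
    using Hoeffding_ineq_abs_ge[OF assms] n_pos mean by (simp add: Z_def n_def)
qed

text \<open>The parameter \<open>3 s / n\<close> is not optimal; it is good enough when the variance is tiny,
  which is the only case where Hoeffding's inequality is too weak.\<close>

lemma small_variance_tail:
  assumes "0 < s" "s \<le> n"
  shows "prob {\<omega> \<in> space M. s \<le> \<bar>Z \<omega>\<bar>} \<le> 2 * exp (- (3 - 99 * v) * s\<^sup>2 / n)"
proof -
  have one_sided: "prob {\<omega> \<in> space M. s \<le> \<sigma> * Z \<omega>} \<le> exp (- (3 - 99 * v) * s\<^sup>2 / n)"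
    if \<sigma>: "\<sigma> \<in> {-1, 1}" for \<sigma> :: real
  proof -
    define t where "t = 3 * s / n"
    \<comment> \<open>The assumption \<open>s \<le> n\<close> keeps the exponents within the range
      of \<open>exp_le_quadratic\<close>.\<close>
    have t: "0 < t" "t \<le> 3"
      using assms n_pos by (auto simp: t_def field_simps)
    let ?E = "\<lambda>i \<omega>. exp (t * (\<sigma> * Y i \<omega>))"
    have le: "\<bar>t * (\<sigma> * Y i \<omega>)\<bar> \<le> 3" if "i \<in> I" "\<omega> \<in> space M" for i \<omega>
      using \<sigma> t abs_Y_le[OF that] mult_mono[of t 3 "\<bar>Y i \<omega>\<bar>" 1] by (auto simp: abs_mult)
    have int: "integrable M (?E i)" if "i \<in> I" for i
      using le that by (intro integrable_bounded[where b = "exp 3"]) (auto simp: abs_le_iff)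
    have mgf: "expectation (?E i) \<le> exp (11 * t\<^sup>2 * v)" if i: "i \<in> I" for i
    proof -
      have "expectation (?E i) \<le> expectation (\<lambda>\<omega>. 1 + t * \<sigma> * Y i \<omega> + 11 * t\<^sup>2 * (Y i \<omega>)\<^sup>2)"
      proof (intro integral_mono int i)
        fix \<omega> assume "\<omega> \<in> space M"
        from exp_le_quadratic[OF le[OF i this]]
        show "?E i \<omega> \<le> 1 + t * \<sigma> * Y i \<omega> + 11 * t\<^sup>2 * (Y i \<omega>)\<^sup>2"
          using \<sigma> by (auto simp: power_mult_distrib)
      qed (use Y_integrable Y_square_integrable i in auto)
      also have "\<dots> = 1 + 11 * t\<^sup>2 * v"
        using Y_integrable Y_square_integrable mean second_moment i by (simp add: prob_space)
      also have "\<dots> \<le> exp (11 * t\<^sup>2 * v)" by simp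
      finally show ?thesis .
    qed
    have indepE: "indep_vars (\<lambda>_. borel) ?E I"
      by (rule indep_vars_compose2[OF indep]) simp
    have Z: "exp (t * (\<sigma> * Z \<omega>)) = (\<Prod>i\<in>I. ?E i \<omega>)" for \<omega>
      using fin by (simp add: Z_def sum_distrib_left exp_sum)
    have "expectation (\<lambda>\<omega>. exp (t * (\<sigma> * Z \<omega>))) = (\<Prod>i\<in>I. expectation (?E i))"
      unfolding Z using indep_vars_lebesgue_integral[OF fin indepE int] by simp
    also have "\<dots> \<le> (\<Prod>i\<in>I. exp (11 * t\<^sup>2 * v))"
      using mgf by (intro prod_mono) (auto intro!: integral_nonneg_AE)
    also have "\<dots> = exp (n * (11 * t\<^sup>2 * v))"
      by (simp add: n_def exp_of_nat_mult)
    finally have E: "expectation (\<lambda>\<omega>. exp (t * (\<sigma> * Z \<omega>))) \<le> exp (n * (11 * t\<^sup>2 * v))" .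
    have "prob {\<omega> \<in> space M. s \<le> \<sigma> * Z \<omega>} = prob {\<omega> \<in> space M. exp (t * s) \<le> exp (t * (\<sigma> * Z \<omega>))}"
      using t by simp
    also have "\<dots> \<le> expectation (\<lambda>\<omega>. exp (t * (\<sigma> * Z \<omega>))) / exp (t * s)"
      using indep_vars_integrable[OF fin indepE int]
      by (intro integral_Markov_inequality_measure[where A = "{}"]) (auto simp: Z prod_nonneg)
    also have "\<dots> \<le> exp (n * (11 * t\<^sup>2 * v)) / exp (t * s)"
      using E by (simp add: divide_right_mono)
    \<comment> \<open>With \<open>t = 3 * s / n\<close>, the exponent
      \<open>11 * n * t^2 * v - t * s\<close> is \<open>(99 * v - 3) * s^2 / n\<close>.\<close>
    also have "\<dots> = exp (- (3 - 99 * v) * s\<^sup>2 / n)"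
      using n_pos by (simp add: t_def field_simps power2_eq_square flip: exp_diff)
    finally show ?thesis .
  qed
  have "{\<omega> \<in> space M. s \<le> \<bar>Z \<omega>\<bar>} = {\<omega> \<in> space M. s \<le> 1 * Z \<omega>} \<union> {\<omega> \<in> space M. s \<le> (-1) * Z \<omega>}"
    by auto
  also have "prob \<dots> \<le> prob {\<omega> \<in> space M. s \<le> 1 * Z \<omega>} + prob {\<omega> \<in> space M. s \<le> (-1) * Z \<omega>}"
    by (intro measure_Un_le) auto
  also have "\<dots> \<le> 2 * exp (- (3 - 99 * v) * s\<^sup>2 / n)"
    using one_sided[of 1] one_sided[of "-1"] by simp
  finally show ?thesis .
qed

section \<open>Anti-concentration of the sum\<close>

text \<open>With \<open>J\<close> the indicator of being inside, \<open>s^2 q\<close> is at most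
  \<open>E (Z clip(Z))\<close> by \<open>mult_clip_ge\<close>. The exchange inequality, applied to
  each summand with the rest frozen, bounds this by the expectation of the sum of all
  \<open>(Y i)^2 + v\<close>, times \<open>J\<close>; where \<open>J = 1\<close>, that sum is at
  most \<open>K\<close>.\<close>

lemma outside_probability_le:
  assumes "0 < s"
  defines "q \<equiv> prob {\<omega> \<in> space M. Z \<omega> \<notin> {-s<..<s+1}}"
  shows "s\<^sup>2 * q \<le> (n * v + n / 4 + (s + 1)\<^sup>2 / n) * (1 - q)"
proof -
  define K where "K = n * v + n / 4 + (s + 1)\<^sup>2 / n"
  define J :: "'a \<Rightarrow> real" where "J \<omega> = indicator {-s<..<s+1} (Z \<omega>)" for \<omega>
  have [measurable]: "J \<in> borel_measurable M"
    unfolding J_def[abs_def] by measurable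
  have J01: "J \<omega> = 0 \<or> J \<omega> = (1::real)" for \<omega>
    by (auto simp: J_def indicator_def)
  have clip: "\<bar>clip s x\<bar> \<le> s + 1" for x
    using abs_clip_le assms by simp
  have intF: "integrable M (\<lambda>\<omega>. Y i \<omega> * clip s (Z \<omega>))" if "i \<in> I" for i
    using that abs_Y_le clip by (intro integrable_bounded[where b = "1 * (s + 1)"])
      (auto simp only: abs_mult intro!: mult_mono, auto)
  have intJ: "integrable M (\<lambda>\<omega>. ((Y i \<omega>)\<^sup>2 + v) * J \<omega>)" if "i \<in> I" for i
  proof (rule integrable_bounded[where b = "1 + v"])
    fix \<omega> assume "\<omega> \<in> space M"
    hence "(Y i \<omega>)\<^sup>2 \<le> 1" using abs_Y_le that by (auto simp: abs_square_le_1)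
    thus "\<bar>((Y i \<omega>)\<^sup>2 + v) * J \<omega>\<bar> \<le> 1 + v"
      using J01[of \<omega>] v_bounds by auto
  qed (use that in measurable)
  have stein: "expectation (\<lambda>\<omega>. Y i \<omega> * clip s (Z \<omega>)) \<le> expectation (\<lambda>\<omega>. ((Y i \<omega>)\<^sup>2 + v) * J \<omega>)"
    if i: "i \<in> I" for i
  proof -
    let ?W = "\<lambda>\<omega>. \<Sum>j\<in>I - {i}. Y j \<omega>"
    \<comment> \<open>The difference of the two sides of the claim, so that freezing
      \<open>w\<close> reduces it to \<open>expectation_mult_clip_le\<close>.\<close>
    let ?h = "\<lambda>y w. y * clip s (w + y) - (y\<^sup>2 + v) * indicator {-s<..<s+1} (w + y)"
    have "expectation (\<lambda>\<omega>. ?h (Y i \<omega>) (?W \<omega>)) \<le> 0"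
    proof (rule indep_var_expectation_nonpos[OF indep_rest[OF i]])
      show "(\<lambda>(y, w). ?h y w) \<in> borel_measurable (borel \<Otimes>\<^sub>M borel)" by measurable
      show "integrable M (\<lambda>\<omega>. ?h (Y i \<omega>) (?W \<omega>))"
        using intF[OF i] intJ[OF i] unfolding J_def by (simp flip: Z_split[OF i])
      fix w
      have "integrable M (\<lambda>\<omega>. Y i \<omega> * clip s (w + Y i \<omega>))"
        using i abs_Y_le clip by (intro integrable_bounded[where b = "1 * (s + 1)"])
          (auto simp only: abs_mult intro!: mult_mono, auto)
      moreover have "integrable M (\<lambda>\<omega>. ((Y i \<omega>)\<^sup>2 + v) * indicator {-s<..<s+1} (w + Y i \<omega>))"
      proof (rule integrable_bounded[where b = "1 + v"])
        fix \<omega> assume "\<omega> \<in> space M"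
        hence "(Y i \<omega>)\<^sup>2 \<le> 1" using abs_Y_le i by (auto simp: abs_square_le_1)
        thus "\<bar>((Y i \<omega>)\<^sup>2 + v) * indicator {-s<..<s+1} (w + Y i \<omega>)\<bar> \<le> 1 + v"
          using v_bounds by (auto simp: indicator_def)
      qed (use i in measurable)
      ultimately show "expectation (\<lambda>\<omega>. ?h (Y i \<omega>) w) \<le> 0"
        using expectation_mult_clip_le[OF rv[OF i] bounds[OF i] mean[OF i] \<open>0 < s\<close>, of w]
          second_moment[OF i] by simp
    qed
    thus ?thesis
      using intF[OF i] intJ[OF i] unfolding J_def by (simp flip: Z_split[OF i])
  qed
  have intJ': "integrable M J"
    using J01 by (intro integrable_bounded[where b = 1]) (auto, metis abs_0 abs_1 order_refl zero_le_one)
  have EJ: "expectation J = 1 - q"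
  proof -
    have "expectation J = prob {\<omega> \<in> space M. Z \<omega> \<in> {-s<..<s+1}}"
    proof -
      have "expectation J = expectation (indicator {\<omega> \<in> space M. Z \<omega> \<in> {-s<..<s+1}})"
        by (intro Bochner_Integration.integral_cong) (auto simp: J_def indicator_def)
      thus ?thesis by simp
    qed
    also have "\<dots> = 1 - q"
      unfolding q_def by (subst prob_neg[symmetric]) auto
    finally show ?thesis .
  qed
  have "s\<^sup>2 * q = expectation (\<lambda>\<omega>. s\<^sup>2 * (1 - J \<omega>))"
    using intJ' EJ by (simp add: prob_space)
  also have "\<dots> \<le> expectation (\<lambda>\<omega>. \<Sum>i\<in>I. Y i \<omega> * clip s (Z \<omega>))"
  proof (intro integral_mono)
    fix \<omega>
    have "s\<^sup>2 * (1 - J \<omega>) \<le> Z \<omega> * clip s (Z \<omega>)"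
      using mult_clip_ge[OF \<open>0 < s\<close>, of "Z \<omega>"] by (simp only: J_def indicator_compl)
    thus "s\<^sup>2 * (1 - J \<omega>) \<le> (\<Sum>i\<in>I. Y i \<omega> * clip s (Z \<omega>))"
      by (simp add: Z_def sum_distrib_right)
  qed (use intJ' intF in auto)
  also have "\<dots> \<le> expectation (\<lambda>\<omega>. \<Sum>i\<in>I. ((Y i \<omega>)\<^sup>2 + v) * J \<omega>)"
    using intF intJ stein by (simp add: Bochner_Integration.integral_sum sum_mono)
  also have "\<dots> \<le> expectation (\<lambda>\<omega>. K * J \<omega>)"
  proof (intro integral_mono)
    fix \<omega> assume \<omega>: "\<omega> \<in> space M"
    have "(\<Sum>i\<in>I. (Y i \<omega>)\<^sup>2 + v) \<le> K" if "Z \<omega> \<in> {-s<..<s+1}"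
    proof -
      \<comment> \<open>Then \<open>m * (1 - m) = (1 - d^2) / 4\<close>: an off-center mean lowers
        the bound on the squares, and this gain pays for the linear term in
        \<open>Z\<close>.\<close>
      define d where "d = \<bar>1 - 2 * m\<bar>"
      have "(\<Sum>i\<in>I. (Y i \<omega>)\<^sup>2 + v) \<le> (\<Sum>i\<in>I. ((1 - 2 * m) * Y i \<omega> + m * (1 - m)) + v)"
        using Y_square_le \<omega> by (intro sum_mono add_mono) auto
      also have "\<dots> = (1 - 2 * m) * Z \<omega> + n * (m * (1 - m)) + n * v"
        by (simp add: sum.distrib Z_def n_def sum_distrib_left)
      also have "n * (m * (1 - m)) = n / 4 - n * d\<^sup>2 / 4"
        by (simp add: d_def power2_eq_square field_simps)
      also have "(1 - 2 * m) * Z \<omega> \<le> d * (s + 1)"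
      proof -
        have "(1 - 2 * m) * Z \<omega> \<le> d * \<bar>Z \<omega>\<bar>" unfolding d_def by (metis abs_ge_self abs_mult)
        also have "\<dots> \<le> d * (s + 1)" using that by (intro mult_left_mono) (auto simp: d_def)
        finally show ?thesis .
      qed
      \<comment> \<open>Completing the square; the term \<open>n * d^2 / 4\<close> cancels, so
        \<open>K\<close> does not depend on \<open>m\<close>.\<close>
      also have "d * (s + 1) \<le> n * d\<^sup>2 / 4 + (s + 1)\<^sup>2 / n"
        using zero_le_power2[of "n * d / 2 - (s + 1)"] n_pos
        by (simp add: field_simps power2_eq_square)
      finally show ?thesis by (simp add: K_def)
    qed
    thus "(\<Sum>i\<in>I. ((Y i \<omega>)\<^sup>2 + v) * J \<omega>) \<le> K * J \<omega>"
      by (simp add: J_def indicator_def flip: sum_distrib_right)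
  qed (use intJ intJ' in auto)
  also have "\<dots> = K * (1 - q)"
    using EJ by simp
  finally show ?thesis by (simp add: K_def)
qed

section \<open>The two-sided deviation bound without the factor 2\<close>

lemma deviation_bound:
  fixes \<kappa> :: real
  assumes n2: "2 \<le> n" and \<kappa>: "0 < \<kappa>"
  defines "c \<equiv> n / (n - 1) + 2 * sqrt v"
  defines "s \<equiv> sqrt (n * \<kappa> / 2) * c"
  shows "prob {\<omega> \<in> space M. Z \<omega> \<notin> {-s<..<s+1}} \<le> exp (- \<kappa>)"
proof -
  define q where "q = prob {\<omega> \<in> space M. Z \<omega> \<notin> {-s<..<s+1}}"
  \<comment> \<open>\<open>w\<close> is the standard deviation scaled to \<open>[0, 1]\<close>, and
    \<open>u\<close> equals \<open>s^2 / n\<close>: Chebyshev's bound reads \<open>v / u\<close> and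
    Hoeffding's \<open>2 * exp (- 2 * u)\<close>.\<close>
  define w where "w = 2 * sqrt v"
  define u where "u = \<kappa> * c\<^sup>2 / 2"
  have w: "0 \<le> w" "w \<le> 1" "v = w\<^sup>2 / 4"
    using v_bounds real_sqrt_le_mono[of v "1/4"]
    by (auto simp: w_def power_mult_distrib real_sqrt_divide)
  have r: "1 + 1 / n \<le> n / (n - 1)"
    using n2 \<kappa> by (simp add: field_simps)
  have c: "1 + w \<le> c" "0 < c"
    using r w divide_pos_pos[OF zero_less_one n_pos] unfolding c_def w_def by linarith+
  have s: "0 < s" "s\<^sup>2 = n * u"
    using c n2 \<kappa> by (auto simp: s_def u_def power_mult_distrib)
  have u_ge: "\<kappa> * (1 + w)\<^sup>2 / 2 \<le> u" "0 < u"
    using c(2) \<kappa> power_mono[OF c(1), of 2] w by (auto simp: u_def)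
  have q_le: "q \<le> prob {\<omega> \<in> space M. s \<le> \<bar>Z \<omega>\<bar>}"
    unfolding q_def using s by (intro finite_measure_mono) auto
  \<comment> \<open>The first threshold is exactly the condition
    \<open>w^2 / 4 + 1 / 4 + 2 * u \<le> (1 + w)^2 / 2\<close>, which the anti-concentration
    argument needs.\<close>
  consider "2 * u \<le> 1/4 + w + w\<^sup>2 / 4" | "1/4 + w + w\<^sup>2 / 4 < 2 * u" "\<kappa> \<le> 1" | "1 < \<kappa>" "\<kappa> \<le> 3" | "3 < \<kappa>"
    by linarith
  thus ?thesis
  proof cases
    case 1
    define K where "K = n * v + n / 4 + (s + 1)\<^sup>2 / n"
    have "0 < K"
      using n_pos v_bounds by (simp add: K_def add_nonneg_pos add_pos_nonneg)
    have "(s + 1)\<^sup>2 \<le> 2 * s\<^sup>2 + 2"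
      using zero_le_power2[of "s - 1"] by (simp add: power2_eq_square algebra_simps)
    hence "(s + 1)\<^sup>2 / n \<le> (2 * s\<^sup>2 + 2) / n"
      using n_pos by (intro divide_right_mono) auto
    also have "\<dots> = 2 * u + 2 / n"
      using n_pos s by (simp add: field_simps)
    also have "\<dots> \<le> n * u + 2 / n"
      using n2 \<kappa> u_ge by simp
    finally have "K + s\<^sup>2 \<le> n * (w\<^sup>2 / 4 + 1 / 4 + 2 * u) + 2 / n"
      unfolding K_def s(2) w(3) by (simp add: algebra_simps)
    also have "\<dots> \<le> n * (w\<^sup>2 / 2 + 1 / 2 + w) + 1"
    proof (rule add_mono[OF mult_left_mono])
      show "w\<^sup>2 / 4 + 1 / 4 + 2 * u \<le> w\<^sup>2 / 2 + 1 / 2 + w" using 1 by linarith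
    qed (use n2 in auto)
    also have "\<dots> = n * ((1 + w)\<^sup>2 / 2 + 1 / n)"
      using n_pos by (simp add: field_simps power2_eq_square)
    \<comment> \<open>The summand \<open>n / (n - 1)\<close> of \<open>c\<close> exceeds
      \<open>1\<close> by at least \<open>1 / n\<close>, and this absorbs the leftover
      \<open>1 / n\<close>.\<close>
    also have "\<dots> \<le> n * (c\<^sup>2 / 2)"
    proof -
      have "2 / n \<le> 2 * (1 + w) / n"
        using w n_pos by (intro divide_right_mono) auto
      hence "(1 + w)\<^sup>2 + 2 / n \<le> (1 + w + 1 / n)\<^sup>2"
        by (simp add: power2_sum[of "1 + w"] add_increasing)
      also have "\<dots> \<le> c\<^sup>2"
      proof (rule power_mono)
        show "1 + w + 1 / n \<le> c" using r unfolding c_def w_def by linarith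
      qed (use w n_pos in simp)
      finally show ?thesis using n_pos by (intro mult_left_mono) auto
    qed
    finally have "\<kappa> * (K + s\<^sup>2) \<le> \<kappa> * (n * (c\<^sup>2 / 2))"
      using n2 \<kappa> by (intro mult_left_mono) auto
    also have "\<dots> = s\<^sup>2" by (simp add: s(2) u_def)
    \<comment> \<open>Together with the anti-concentration bound this yields
      \<open>q \<le> 1 - \<kappa>\<close>, which is at most \<open>exp (- \<kappa>)\<close>.\<close>
    finally have "\<kappa> \<le> s\<^sup>2 / (K + s\<^sup>2)"
      using \<open>0 < K\<close> by (simp add: pos_le_divide_eq add_pos_nonneg)
    moreover have "q \<le> 1 - s\<^sup>2 / (K + s\<^sup>2)"
    proof -
      have pos: "0 < K + s\<^sup>2" using \<open>0 < K\<close> by (simp add: add_pos_nonneg)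
      have "q * (K + s\<^sup>2) \<le> K"
        using outside_probability_le[OF s(1)] unfolding q_def[symmetric] K_def[symmetric]
        by (simp add: algebra_simps)
      hence "q \<le> K / (K + s\<^sup>2)" using pos by (simp add: pos_le_divide_eq)
      also have "\<dots> = 1 - s\<^sup>2 / (K + s\<^sup>2)" using pos by (simp add: diff_divide_eq_iff)
      finally show ?thesis .
    qed
    ultimately have "q \<le> 1 + (- \<kappa>)" by linarith
    also have "\<dots> \<le> exp (- \<kappa>)" by (rule exp_ge_add_one_self)
    finally show ?thesis by (simp add: q_def)
  next
    case 2
    have "q \<le> v / u"
      using order_trans[OF q_le Chebyshev[OF s(1)]] n_pos by (simp add: s(2))
    also have "v / u \<le> 1 / 3"
    proof -
      have "w\<^sup>2 \<le> w" using w by (simp add: power2_eq_square mult_left_le)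
      \<comment> \<open>As \<open>w^2 \<le> w \<le> 1\<close>, one has
        \<open>3 * w^2 / 2 \<le> 1 / 4 + w + w^2 / 4 < 2 * u\<close>, and
        \<open>v = w^2 / 4\<close>.\<close>
      hence "3 * v \<le> u" using 2 w by (simp add: field_simps)
      thus ?thesis using u_ge by (simp add: field_simps)
    qed
    also have "1 / 3 \<le> exp (- 1 :: real)"
      using exp_le by (simp add: exp_minus field_simps)
    also have "\<dots> \<le> exp (- \<kappa>)" using 2 by simp
    finally show ?thesis by (simp add: q_def)
  next
    case 3
    have "q \<le> v / u"
      using order_trans[OF q_le Chebyshev[OF s(1)]] n_pos by (simp add: s(2))
    also have "v / u \<le> 1 / (8 * \<kappa>)"
    proof -
      have "4 * w \<le> (1 + w)\<^sup>2" using zero_le_power2[of "1 - w"] by (simp add: power2_eq_square algebra_simps)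
      moreover have "w\<^sup>2 \<le> w" using w by (simp add: power2_eq_square mult_left_le)
      ultimately have "4 * w\<^sup>2 \<le> (1 + w)\<^sup>2" by linarith
      hence "\<kappa> * (4 * w\<^sup>2) / 2 \<le> \<kappa> * (1 + w)\<^sup>2 / 2" using n2 \<kappa> by simp
      also note u_ge(1)
      finally have "8 * \<kappa> * v \<le> u" unfolding w(3) by simp
      thus ?thesis using u_ge(2) \<kappa> by (simp add: field_simps)
    qed
    also have "\<dots> \<le> exp (- \<kappa>)"
    proof -
      \<comment> \<open>To get \<open>exp \<kappa> \<le> 8 * \<kappa>\<close> on
        \<open>[1, 3]\<close>, both sides are multiplied by \<open>4 - \<kappa>\<close>; the
        remaining inequality is \<open>(\<kappa> - 1) * (3 - \<kappa>) \<ge> 0\<close>.\<close>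
      have "exp \<kappa> * (4 - \<kappa>) \<le> exp \<kappa> * exp (3 - \<kappa>)"
        using exp_ge_add_one_self[of "3 - \<kappa>"] by (intro mult_left_mono) auto
      also have "\<dots> = exp 3" by (simp flip: exp_add)
      also have "\<dots> \<le> 24" using exp_3_le by simp
      also have "\<dots> \<le> 8 * \<kappa> * (4 - \<kappa>)"
        using 3 mult_nonneg_nonneg[of "\<kappa> - 1" "3 - \<kappa>"] by (simp add: algebra_simps)
      finally have "exp \<kappa> \<le> 8 * \<kappa>"
        by (rule mult_right_le_imp_le) (use 3 in simp)
      thus ?thesis using n2 \<kappa> by (simp add: exp_minus field_simps)
    qed
    finally show ?thesis by (simp add: q_def)
  next
    case 4
    \<comment> \<open>The surplus \<open>0.234 * \<kappa> > 0.702\<close> exceeds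
      \<open>25 / 36 \<ge> ln 2\<close> and so absorbs the factor \<open>2\<close>.\<close>
    have tail: "2 * exp (- a * s\<^sup>2 / n) \<le> exp (- \<kappa>)" if "1.234 * \<kappa> \<le> a * u" for a
    proof -
      have "ln 2 \<le> a * u - \<kappa>"
        using that ln2_le_25_over_36 4 by simp
      hence "exp (ln 2) \<le> exp (a * u - \<kappa>)" by (simp only: exp_le_cancel_iff)
      hence "2 * exp (- a * u) \<le> exp (a * u - \<kappa>) * exp (- a * u)"
        by simp
      thus ?thesis using n_pos by (simp add: s(2) flip: exp_add)
    qed
    \<comment> \<open>Hoeffding's exponent \<open>2 * u\<close> suffices for
      \<open>w \<ge> 3 / 25\<close>, since \<open>(28 / 25)^2 > 1.234\<close>. Below that,
      \<open>v \<le> 0.0036\<close> and the small-variance exponent is at least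
      \<open>2.64 * \<kappa> / 2 = 1.32 * \<kappa>\<close>. For \<open>s > n\<close> the event is
      empty.\<close>
    consider "3 / 25 \<le> w" | "w < 3 / 25" "s \<le> n" | "n < s"
      by linarith
    thus ?thesis
    proof cases
      case 1
      have "(28 / 25)\<^sup>2 \<le> (1 + w)\<^sup>2"
        using 1 by (intro power_mono) auto
      hence "\<kappa> * (28 / 25)\<^sup>2 / 2 \<le> \<kappa> * (1 + w)\<^sup>2 / 2"
        using \<kappa> by simp
      hence "\<kappa> * (28 / 25)\<^sup>2 / 2 \<le> u"
        using u_ge(1) by linarith
      hence "\<kappa> * 1.254 \<le> 2 * u"
        using \<kappa> by (simp add: power2_eq_square)
      hence "2 * exp (- 2 * s\<^sup>2 / n) \<le> exp (- \<kappa>)"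
        using 4 by (intro tail) simp
      thus ?thesis
        using order_trans[OF q_le Hoeffding[of s]] s by (simp add: q_def)
    next
      case 2
      have "w\<^sup>2 \<le> (3 / 25)\<^sup>2"
        using 2 w by (intro power_mono) auto
      hence v: "2.64 \<le> 3 - 99 * v" using w by (simp add: power2_eq_square)
      have "\<kappa> * 1 / 2 \<le> \<kappa> * (1 + w)\<^sup>2 / 2"
        using w 4 by (intro divide_right_mono mult_left_mono) auto
      hence "\<kappa> / 2 \<le> u" using u_ge(1) by simp
      hence "2.64 * (\<kappa> / 2) \<le> (3 - 99 * v) * u"
        using v 4 by (intro mult_mono) auto
      hence "2 * exp (- (3 - 99 * v) * s\<^sup>2 / n) \<le> exp (- \<kappa>)"
        using 4 by (intro tail) simp
      thus ?thesis
        using order_trans[OF q_le small_variance_tail[OF s(1) 2(2)]] by (simp add: q_def)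
    next
      case 3
      hence empty: "{\<omega> \<in> space M. s \<le> \<bar>Z \<omega>\<bar>} = {}"
        using abs_Z_le by force
      have "q \<le> 0" using q_le unfolding empty by simp
      also have "0 \<le> exp (- \<kappa>)" by simp
      finally show ?thesis unfolding q_def .
    qed
  qed
qed

end

section \<open>From the deviation of the sum to the risks\<close>

text \<open>The difference is the total loss of the \<open>n - B\<close> unselected
  candidates.\<close>

lemma unselected_loss_bounds:
  assumes z: "top_indicators n B s z" and ls: "\<And>i. i \<in> {1..n} \<Longrightarrow> 0 \<le> ls i \<and> ls i \<le> L"
  shows "0 \<le> (\<Sum>i=1..n. ls i) - (\<Sum>i=1..n. z i * ls i)"
    and "(\<Sum>i=1..n. ls i) - (\<Sum>i=1..n. z i * ls i) \<le> L * (real n - real B)"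
proof -
  have z01: "z i = 0 \<or> z i = 1" if "i \<in> {1..n}" for i
    using z that by (auto simp: top_indicators_def)
  have eq: "(\<Sum>i=1..n. ls i) - (\<Sum>i=1..n. z i * ls i) = (\<Sum>i=1..n. (1 - z i) * ls i)"
    by (simp add: algebra_simps sum_subtractf)
  show "0 \<le> (\<Sum>i=1..n. ls i) - (\<Sum>i=1..n. z i * ls i)"
    unfolding eq using z01 ls by (intro sum_nonneg) force
  have "(\<Sum>i=1..n. (1 - z i) * ls i) \<le> (\<Sum>i=1..n. (1 - z i) * L)"
    using z01 ls by (intro sum_mono mult_left_mono) force+
  also have "\<dots> = L * (real n - (\<Sum>i=1..n. z i))"
    by (simp add: sum_subtractf flip: sum_distrib_right)
  also have "\<dots> = L * (real n - real B)"
    using z by (simp add: top_indicators_def)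
  finally show "(\<Sum>i=1..n. ls i) - (\<Sum>i=1..n. z i * ls i) \<le> L * (real n - real B)"
    unfolding eq .
qed

text \<open>The left side is \<open>L * s / n\<close> for the \<open>s\<close> of
  \<open>deviation_bound\<close>. Its part with \<open>n / (n - 1)\<close> goes into the second root
  because \<open>B \<le> n - 1\<close>; the part with the standard deviation is
  \<open>sqrt (V * (2 * \<kappa> / n))\<close>, and the summand \<open>L / 3\<close> is
  slack.\<close>

lemma deviation_scale_le:
  fixes n B V L \<kappa> :: real
  assumes "0 < L" "0 \<le> V" "0 < \<kappa>" "0 < B" "B \<le> n - 1"
  shows "L * (sqrt (n * \<kappa> / 2) * (n / (n - 1) + 2 * sqrt (V / L\<^sup>2))) / n \<le>
    sqrt ((V + L / 3) * (2 * \<kappa> / n)) + L * sqrt (n / (2 * B\<^sup>2) * \<kappa>)"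
proof -
  have n: "0 < n" using assms by simp
  have "L * (sqrt (n * \<kappa> / 2) * (n / (n - 1) + 2 * sqrt (V / L\<^sup>2))) / n =
      L * (sqrt (n * \<kappa> / 2) / (n - 1)) + 2 * sqrt V * (sqrt (n * \<kappa> / 2) / n)"
    using assms n by (simp add: real_sqrt_divide field_simps)
  also have "sqrt (n * \<kappa> / 2) / (n - 1) \<le> sqrt (n * \<kappa> / 2) / B"
    using assms by (intro divide_left_mono) auto
  also have "\<dots> = sqrt (n / (2 * B\<^sup>2) * \<kappa>)"
    using assms by (simp add: real_sqrt_divide real_sqrt_mult)
  also have "2 * sqrt V * (sqrt (n * \<kappa> / 2) / n) = sqrt (2\<^sup>2 * V * (n * \<kappa> / 2 / n\<^sup>2))"
    unfolding real_sqrt_mult[of "2\<^sup>2 * V"] real_sqrt_mult[of "2\<^sup>2"] real_sqrt_divide[of _ "n\<^sup>2"]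
    using n by simp
  also have "\<dots> = sqrt (V * (2 * \<kappa> / n))"
    using n by (simp add: power2_eq_square)
  also have "\<dots> \<le> sqrt ((V + L / 3) * (2 * \<kappa> / n))"
    using assms n by (intro real_sqrt_le_mono mult_right_mono) auto
  finally show ?thesis
    using assms by (simp add: mult_left_mono)
qed

theorem theorem4p2:
  fixes M :: "'w measure"
    and MX :: "'x measure" and MY :: "'y measure" and p :: "('x \<times> 'y) measure"
    and \<Theta> :: "'t set" and \<Phi> :: "'h set"
    and f :: "'t \<Rightarrow> 'x \<Rightarrow> 'o" and l :: "'o \<Rightarrow> 'y \<Rightarrow> real" and g :: "'h \<Rightarrow> 'x \<Rightarrow> real"
    and Lmax \<epsilon> :: real
    and \<theta>s :: 't and \<phi>s :: 'h
    and B Bhat :: nat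
    and X :: "nat \<Rightarrow> 'w \<Rightarrow> 'x" and Y :: "nat \<Rightarrow> 'w \<Rightarrow> 'y"
    and z :: "nat \<Rightarrow> 'w \<Rightarrow> real"
  assumes "prob_space M"
    and "prob_space p" and "sets p = sets (MX \<Otimes>\<^sub>M MY)"
    and learned: "\<theta>s \<in> \<Theta>" "\<phi>s \<in> \<Phi>"
    and loss_nonneg: "\<forall>\<theta>\<in>\<Theta>. \<forall>x\<in>space MX. \<forall>y\<in>space MY. 0 \<le> l (f \<theta> x) y"
    and loss_bounded: "\<forall>\<theta>\<in>\<Theta>. \<forall>x\<in>space MX. \<forall>y\<in>space MY. l (f \<theta> x) y \<le> Lmax"
    and Lmax_pos: "0 < Lmax"
    and loss_measurable: "sample_loss l f \<theta>s \<in> borel_measurable p"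
    and sizes: "1 \<le> B" "B < Bhat"
    and independent: "prob_space.indep_vars M (\<lambda>_. p) (\<lambda>i \<omega>. (X i \<omega>, Y i \<omega>)) {1..Bhat}"
    and distributed: "\<forall>i\<in>{1..Bhat}. distr M p (\<lambda>\<omega>. (X i \<omega>, Y i \<omega>)) = p"
    and z_measurable: "\<forall>i\<in>{1..Bhat}. z i \<in> borel_measurable M"
    and z_top: "\<forall>\<omega>\<in>space M. top_indicators Bhat B (\<lambda>i. g \<phi>s (X i \<omega>)) (\<lambda>i. z i \<omega>)"
    and \<epsilon>: "0 < \<epsilon>" "\<epsilon> < 1"
  shows "measure M {\<omega> \<in> space M.
           \<bar>true_risk p l f \<theta>s
              - selected_risk Bhat (\<lambda>i. z i \<omega>) (\<lambda>i. sample_loss l f \<theta>s (X i \<omega>, Y i \<omega>))\<bar>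
           < sqrt ((prob_space.variance p (sample_loss l f \<theta>s) + Lmax / 3)
                     * (2 * ln (1 / \<epsilon>) / real Bhat))
             + Lmax * sqrt (real Bhat / (2 * (real B)\<^sup>2) * ln (1 / \<epsilon>))
             + Lmax * (real Bhat - real B) / real Bhat} \<ge> 1 - \<epsilon>"
proof -
  interpret prob_space M by fact
  interpret p: prob_space p by fact
  define h where "h = sample_loss l f \<theta>s"
  define R where "R = p.expectation h"
  define V where "V = p.variance h"
  define L where "L = Lmax"
  define n where "n = real Bhat"
  define \<kappa> where "\<kappa> = ln (1 / \<epsilon>)"
  define loss where "loss i \<omega> = h (X i \<omega>, Y i \<omega>)" for i \<omega>
  define U where "U i \<omega> = (loss i \<omega> - R) / L" for i \<omega>
  have L: "0 < L" using Lmax_pos by (simp add: L_def)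
  have \<kappa>: "0 < \<kappa>" "exp (- \<kappa>) = \<epsilon>"
    using \<epsilon> by (auto simp: \<kappa>_def ln_div)
  have h [measurable]: "h \<in> borel_measurable p"
    using loss_measurable by (simp add: h_def)
  have "space p = space MX \<times> space MY"
    using sets_eq_imp_space_eq[OF \<open>sets p = _\<close>] by (simp add: space_pair_measure)
  hence h_bounds: "0 \<le> h a" "h a \<le> L" if "a \<in> space p" for a
    using that learned loss_nonneg loss_bounded by (auto simp: h_def L_def sample_loss_def)
  have h_int: "integrable p h"
    using h_bounds by (intro p.integrable_const_bound[where B = L]) auto
  have XY [measurable]: "(\<lambda>\<omega>. (X i \<omega>, Y i \<omega>)) \<in> measurable M p" if "i \<in> {1..Bhat}" for i
    using independent that by (auto simp: indep_vars_def)
  have loss_rv [measurable]: "loss i \<in> borel_measurable M" if "i \<in> {1..Bhat}" for i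
    unfolding loss_def[abs_def] using measurable_compose[OF XY[OF that] h] .
  have loss_bounds: "0 \<le> loss i \<omega> \<and> loss i \<omega> \<le> L" if "i \<in> {1..Bhat}" "\<omega> \<in> space M" for i \<omega>
    using h_bounds measurable_space[OF XY that(2)] that(1) by (auto simp: loss_def)
  have transfer: "expectation (\<lambda>\<omega>. F (loss i \<omega>)) = p.expectation (\<lambda>a. F (h a))"
    if "i \<in> {1..Bhat}" "F \<in> borel_measurable borel" for i and F :: "real \<Rightarrow> real"
  proof -
    have "p.expectation (\<lambda>a. F (h a)) =
        integral\<^sup>L (distr M p (\<lambda>\<omega>. (X i \<omega>, Y i \<omega>))) (\<lambda>a. F (h a))"
      using distributed that by simp
    also have "\<dots> = expectation (\<lambda>\<omega>. F (loss i \<omega>))"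
      using that by (subst integral_distr[OF XY]) (auto simp: loss_def)
    finally show ?thesis ..
  qed
  interpret C: centered_sample M U "{1..Bhat}" "R / L" "V / L\<^sup>2"
  proof
    show "finite {1..Bhat}" "{1..Bhat} \<noteq> {}" using sizes by auto
    show "indep_vars (\<lambda>_. borel) U {1..Bhat}"
      unfolding U_def[abs_def] loss_def
      by (rule indep_vars_compose2[OF independent]) simp
  next
    fix i \<omega> assume "i \<in> {1..Bhat}" "\<omega> \<in> space M"
    from loss_bounds[OF this] show "U i \<omega> \<in> {- (R / L)..1 - R / L}"
      using L by (simp add: U_def field_simps)
  next
    fix i assume i: "i \<in> {1..Bhat}"
    show "expectation (U i) = 0"
      using transfer[OF i, of "\<lambda>t. (t - R) / L"] h_int by (simp add: U_def[abs_def] R_def p.prob_space)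
    show "expectation (\<lambda>\<omega>. (U i \<omega>)\<^sup>2) = V / L\<^sup>2"
      using transfer[OF i, of "\<lambda>t. ((t - R) / L)\<^sup>2"] by (simp add: U_def power_divide V_def R_def)
  qed
  have Cn: "C.n = n" unfolding C.n_def n_def by simp
  have nB: "2 \<le> n" "real B \<le> n - 1" "0 < real B" using sizes by (auto simp: n_def)
  define s where "s = sqrt (n * \<kappa> / 2) * (n / (n - 1) + 2 * sqrt (V / L\<^sup>2))"
  define good where "good = {\<omega> \<in> space M. C.Z \<omega> \<in> {-s<..<s+1}}"
  have "1 - \<epsilon> \<le> prob good"
  proof -
    have "prob {\<omega> \<in> space M. C.Z \<omega> \<notin> {-s<..<s+1}} \<le> \<epsilon>"
      using C.deviation_bound[of \<kappa>] \<kappa> nB unfolding Cn s_def by simp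
    moreover have "prob {\<omega> \<in> space M. C.Z \<omega> \<notin> {-s<..<s+1}} = 1 - prob good"
      unfolding good_def by (rule prob_neg) measurable
    ultimately show ?thesis by simp
  qed
  also have "prob good \<le> measure M {\<omega> \<in> space M.
      \<bar>R - selected_risk Bhat (\<lambda>i. z i \<omega>) (\<lambda>i. loss i \<omega>)\<bar>
      < sqrt ((V + L / 3) * (2 * \<kappa> / n)) + L * sqrt (n / (2 * (real B)\<^sup>2) * \<kappa>) + L * (n - real B) / n}"
    (is "_ \<le> measure M {\<omega> \<in> space M. \<bar>R - ?Rhat \<omega>\<bar> < ?A + _}")
  proof (rule finite_measure_mono)
    show "good \<subseteq> {\<omega> \<in> space M. \<bar>R - ?Rhat \<omega>\<bar> < ?A + L * (n - real B) / n}"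
    proof
      fix \<omega> assume "\<omega> \<in> good"
      hence \<omega>: "\<omega> \<in> space M" and Z: "- s < C.Z \<omega>" "C.Z \<omega> < s + 1"
        by (auto simp: good_def)
      define D where "D = (\<Sum>i=1..Bhat. loss i \<omega>) - (\<Sum>i=1..Bhat. z i \<omega> * loss i \<omega>)"
      have D: "0 \<le> D" "D \<le> L * (n - real B)"
        using unselected_loss_bounds[of Bhat B _ "\<lambda>i. z i \<omega>" "\<lambda>i. loss i \<omega>" L] z_top \<omega> loss_bounds
        unfolding D_def n_def by blast+
      have "L * C.Z \<omega> = (\<Sum>i=1..Bhat. loss i \<omega>) - n * R"
        unfolding C.Z_def U_def n_def using L by (simp add: sum_subtractf flip: sum_divide_distrib)
      \<comment> \<open>The selection error \<open>D\<close> is nonnegative, so it only pushes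
        \<open>R\<close> above the selected risk; the two directions of the deviation are therefore
        asymmetric.\<close>
      hence eq: "n * (R - ?Rhat \<omega>) = D - L * C.Z \<omega>"
        using nB by (simp add: D_def selected_risk_def n_def algebra_simps)
      have LZ: "- (L * s) < L * C.Z \<omega>" "L * C.Z \<omega> < L * s + L"
        using L Z mult_strict_left_mono[OF Z(1) L] mult_strict_left_mono[OF Z(2) L]
        by (auto simp: algebra_simps)
      \<comment> \<open>At least one candidate is left out, so the last summand of the bound covers
        the extra \<open>L\<close> that comes from the endpoint \<open>s + 1\<close>.\<close>
      have "L \<le> L * (n - real B)"
        using nB L by simp
      hence "\<bar>n * (R - ?Rhat \<omega>)\<bar> < L * s + L * (n - real B)"
        unfolding eq using LZ D by linarith
      hence "n * \<bar>R - ?Rhat \<omega>\<bar> < L * s + L * (n - real B)"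
        using nB by (simp only: abs_mult)
      hence "\<bar>R - ?Rhat \<omega>\<bar> < L * s / n + L * (n - real B) / n"
        using nB by (simp add: field_simps)
      also have "L * s / n \<le> ?A"
        unfolding s_def using deviation_scale_le[of L V \<kappa> "real B" n] L \<kappa> nB
        by (simp add: V_def integral_nonneg_AE)
      finally show "\<omega> \<in> {\<omega> \<in> space M. \<bar>R - ?Rhat \<omega>\<bar> < ?A + L * (n - real B) / n}"
        using \<omega> by simp
    qed
    have "(\<lambda>\<omega>. ?Rhat \<omega>) \<in> borel_measurable M"
      unfolding selected_risk_def
      by (intro borel_measurable_times borel_measurable_sum borel_measurable_const loss_rv
        z_measurable[rule_format])
    thus "{\<omega> \<in> space M. \<bar>R - ?Rhat \<omega>\<bar> < ?A + L * (n - real B) / n} \<in> events"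
      by (intro borel_measurable_less borel_measurable_abs borel_measurable_diff borel_measurable_const)
  qed
  finally show ?thesis
    unfolding R_def V_def L_def n_def \<kappa>_def loss_def h_def true_risk_def .
qed

end
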